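(* Let $Y$ be any digital image. Suppose that a path (continuous map) $\gamma\colon I_N\to Y$ has $\gamma(0)=y_0'$ and $\gamma(N)=y_0$. Then there is an isomorphism of fundamental groups $$\Phi\colon \pi_1(Y;y_0')\to\pi_1(Y;y_0)$$ defined by setting $\Phi([\alpha])=[\overline{\gamma}\cdot\alpha\cdot\gamma]$ for each $\alpha\colon I_M\to Y$ with $\alpha(0)=y_0'=\alpha(M)$, where $\overline{\gamma}(t)=\gamma(N-t)$ is the reverse path.
   Context: A digital image is a finite subset $Y \subseteq \mathbb{Z}^n$ with adjacency relation $x \sim_Y y$ iff $|x_i - y_i| \le 1$ for every $i=1,\dots,n$. A function of digital images is continuous if it sends adjacent points to adjacent points. $I_N = \{0,1,\dots,N\}\subseteq\mathbb{Z}$, and $I_M\times I_R \subseteq \mathbb{Z}^2$ has $(s,t)\sim(s',t')$ iff $|s-s'|\le 1$ and $|t-t'|\le 1$. A path of length $N$ in $Y$ is a continuous map $I_N\to Y$. Fix a basepoint $y_0\in Y$. A based loop of length $N\ge 1$ is a path $\gamma\colon I_N\to Y$ with $\gamma(0)=\gamma(N)=y_0$. Based loops $\alpha,\beta\colon I_M\to Y$ of the same length are based homotopic as based loops, $\alpha\approx\beta$, if for some $R\ge1$ there is a continuous $H\colon I_M\times I_R\to Y$ with $H(s,0)=\alpha(s)$, $H(s,R)=\beta(s)$ and $H(0,t)=H(M,t)=y_0$ for all $s,t$. For $k\ge1$, $\rho_k\colon I_{kN+k-1}\to I_N$ is $\rho_k(s)=\lfloor s/k\rfloor$. Based loops $\alpha\colon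 I_M\to Y$, $\beta\colon I_N\to Y$ are subdivision-based homotopic as based loops if for some $k,l\ge1$ with $k(M+1)=l(N+1)$ we have $\alpha\circ\rho_k\approx\beta\circ\rho_l$ as based loops. This is an equivalence relation; $[\alpha]$ denotes the class of $\alpha$ and $\pi_1(Y;y_0)$ the set of classes. For paths $\alpha\colon I_M\to Y$, $\beta\colon I_N\to Y$ with $\alpha(M)\sim_Y\beta(0)$, the concatenation $\alpha\cdot\beta\colon I_{M+N+1}\to Y$ is given by $\alpha(t)$ for $0\le t\le M$ and $\beta(t-(M+1))$ for $M+1\le t\le M+N+1$; it is associative. $\pi_1(Y;y_0)$ is a group under the well-defined product $[\alpha]\cdot[\beta]=[\alpha\cdot\beta]$. *)

theory Defs
  imports "HOL-Analysis.Finite_Cartesian_Product" "HOL-Algebra.Group"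
begin

definition digital_image :: "(int ^ 'n) set \<Rightarrow> bool" where
  "digital_image Y \<longleftrightarrow> finite Y"

definition adj :: "int ^ 'n \<Rightarrow> int ^ 'n \<Rightarrow> bool" where
  "adj x y \<longleftrightarrow> (\<forall>i. \<bar>x $ i - y $ i\<bar> \<le> 1)"

text \<open>The intervals \<open>I\<^sub>N = {0, 1, \<dots>, N}\<close> are encoded as \<open>{..N} :: nat set\<close>, and
  \<open>I\<^sub>M \<times> I\<^sub>R\<close> as a set of pairs, with the adjacencies inherited from the integers.\<close>

definition adj_interval :: "nat \<Rightarrow> nat \<Rightarrow> bool" where
  "adj_interval s t \<longleftrightarrow> \<bar>int s - int t\<bar> \<le> 1"

definition adj_rectangle :: "nat \<times> nat \<Rightarrow> nat \<times> nat \<Rightarrow> bool" where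
  "adj_rectangle p q \<longleftrightarrow> adj_interval (fst p) (fst q) \<and> adj_interval (snd p) (snd q)"

definition digitally_continuous ::
    "('a \<Rightarrow> 'a \<Rightarrow> bool) \<Rightarrow> 'a set \<Rightarrow> ('b \<Rightarrow> 'b \<Rightarrow> bool) \<Rightarrow> 'b set \<Rightarrow> ('a \<Rightarrow> 'b) \<Rightarrow> bool" where
  "digitally_continuous adjX X adjY Y f \<longleftrightarrow>
     f \<in> X \<rightarrow> Y \<and> (\<forall>x\<in>X. \<forall>x'\<in>X. adjX x x' \<longrightarrow> adjY (f x) (f x'))"

text \<open>A map \<open>I\<^sub>N \<rightarrow> Y\<close> is a pair of its length \<open>N\<close> and a function that is
  \<open>undefined\<close> outside \<open>{..N}\<close>, so that equality of pairs is equality of maps.\<close>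

type_synonym 'n dpath = "nat \<times> (nat \<Rightarrow> int ^ 'n)"

definition digital_path :: "(int ^ 'n) set \<Rightarrow> 'n dpath \<Rightarrow> bool" where
  "digital_path Y = (\<lambda>(N, \<gamma>). \<gamma> \<in> extensional {..N} \<and>
     digitally_continuous adj_interval {..N} adj Y \<gamma>)"

definition based_loops :: "(int ^ 'n) set \<Rightarrow> int ^ 'n \<Rightarrow> 'n dpath set" where
  "based_loops Y y0 = {(N, \<gamma>). N \<ge> 1 \<and> digital_path Y (N, \<gamma>) \<and> \<gamma> 0 = y0 \<and> \<gamma> N = y0}"

definition based_homotopic :: "(int ^ 'n) set \<Rightarrow> int ^ 'n \<Rightarrow> 'n dpath \<Rightarrow> 'n dpath \<Rightarrow> bool" where
  "based_homotopic Y y0 = (\<lambda>(M, \<alpha>) (N, \<beta>).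
     (M, \<alpha>) \<in> based_loops Y y0 \<and> (N, \<beta>) \<in> based_loops Y y0 \<and> M = N \<and>
     (\<exists>R\<ge>1. \<exists>H :: nat \<times> nat \<Rightarrow> int ^ 'n.
        digitally_continuous adj_rectangle ({..M} \<times> {..R}) adj Y H \<and>
        (\<forall>s\<le>M. H (s, 0) = \<alpha> s \<and> H (s, R) = \<beta> s) \<and>
        (\<forall>t\<le>R. H (0, t) = y0 \<and> H (M, t) = y0)))"

definition rho :: "nat \<Rightarrow> nat \<Rightarrow> nat" where
  "rho k s = s div k"

text \<open>\<open>subdivide k (N, \<alpha>)\<close> is \<open>\<alpha> \<circ> \<rho>\<^sub>k\<close> with domain \<open>{..k * N + k - 1}\<close>; only used for \<open>k \<ge> 1\<close>.\<close>

definition subdivide :: "nat \<Rightarrow> 'n dpath \<Rightarrow> 'n dpath" where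
  "subdivide k = (\<lambda>(N, \<alpha>). (k * N + k - 1, compose {..k * N + k - 1} \<alpha> (rho k)))"

definition subdivision_homotopy :: "(int ^ 'n) set \<Rightarrow> int ^ 'n \<Rightarrow> ('n dpath \<times> 'n dpath) set" where
  "subdivision_homotopy Y y0 = {((M, \<alpha>), (N, \<beta>)).
     (M, \<alpha>) \<in> based_loops Y y0 \<and> (N, \<beta>) \<in> based_loops Y y0 \<and>
     (\<exists>k\<ge>1. \<exists>l\<ge>1. k * (M + 1) = l * (N + 1) \<and>
        based_homotopic Y y0 (subdivide k (M, \<alpha>)) (subdivide l (N, \<beta>)))}"

definition loop_class :: "(int ^ 'n) set \<Rightarrow> int ^ 'n \<Rightarrow> 'n dpath \<Rightarrow> 'n dpath set" where
  "loop_class Y y0 \<alpha> = subdivision_homotopy Y y0 `` {\<alpha>}"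

definition path_concat :: "'n dpath \<Rightarrow> 'n dpath \<Rightarrow> 'n dpath"  (infixr "\<cdot>" 70) where
  "path_concat = (\<lambda>(M, \<alpha>) (N, \<beta>).
     (M + N + 1, \<lambda>t\<in>{..M + N + 1}. if t \<le> M then \<alpha> t else \<beta> (t - (M + 1))))"

definition path_reverse :: "'n dpath \<Rightarrow> 'n dpath" where
  "path_reverse = (\<lambda>(N, \<gamma>). (N, \<lambda>t\<in>{..N}. \<gamma> (N - t)))"

text \<open>The union in the product is the usual rendering of an operation on classes defined through
  representatives: it is the class of \<open>a \<cdot> b\<close> for any \<open>a \<in> A\<close>, \<open>b \<in> B\<close>, since this class
  does not depend on the choice. The unit is the class of a constant loop, of length 1 because
  based loops have positive length.\<close>

definition fundamental_group :: "(int ^ 'n) set \<Rightarrow> int ^ 'n \<Rightarrow> 'n dpath set monoid" where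
  "fundamental_group Y y0 =
     \<lparr>carrier = based_loops Y y0 // subdivision_homotopy Y y0,
      mult = (\<lambda>A B. \<Union>a\<in>A. \<Union>b\<in>B. loop_class Y y0 (a \<cdot> b)),
      one = loop_class Y y0 (1, \<lambda>t\<in>{..1}. y0)\<rparr>"

end

theory Submission
  imports Defs
begin

text \<open>
  The usual proof that a path from \<open>y0'\<close> to \<open>y0\<close> induces an isomorphism of fundamental groups
  conjugates loops by the path and cancels a path against its reverse. The difficulty in the digital
  setting lies in the equivalence relation: two loops are equivalent if some subdivisions of them,
  at possibly different rates, are homotopic with fixed endpoints and fixed length. It is neither
  evidently transitive nor evidently compatible with concatenation.

  The relation is therefore replaced by a local one. A path is the list of its points, and two lists
  are related by \<open>deform\<close> if they are connected by a sequence of two kinds of steps or their inverses: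
  a \<open>move\<close> changes one interior vertex to an adjacent one, and a \<open>stutter\<close> repeats a vertex. This is an
  equivalence relation and a congruence for \<open>@\<close> by construction. It agrees with subdivision-based
  homotopy for two reasons. First, a homotopy on a rectangle is a sequence of moves, since
  consecutive rows can be exchanged vertex by vertex (\<open>moves_if_rows_adjacent\<close>), and every move is a
  homotopy of height 1 (\<open>move_nth_adj\<close>). Secondly, subdivision is repeated stuttering, and a repetition
  can be moved along a walk to its end (\<open>moves_shift_stutter\<close>), so that the result of stuttering
  depends up to moves only on the original walk and the final length. Therefore any deformation can be
  turned into a sequence of moves between sufficiently fine subdivisions (\<open>deform_iff_repeat_each\<close>).

  After this translation (\<open>subdivision_homotopy_iff_deform\<close>), the group laws and the isomorphism rest, apart
  from the removal of repetitions, on a single contraction: \<open>rev xs @ xs\<close> deforms to its endpoint (\<open>deform_rev_append\<close>), one detour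
  \<open>y, x, y\<close> at a time.
\<close>

lemma adj_refl [simp]: "adj x x"
  by (simp add: adj_def)

lemma adj_sym: "adj x y \<Longrightarrow> adj y x"
  by (simp add: adj_def abs_minus_commute)

section \<open>Paths as lists and their elementary deformations\<close>

text \<open>Paths become nonempty lists of points, so that concatenation is \<open>@\<close>, reversal is \<open>rev\<close>
  and there are no index shifts.\<close>

definition walk :: "(int ^ 'n) set \<Rightarrow> (int ^ 'n) list \<Rightarrow> bool" where
  "walk Y xs \<longleftrightarrow> xs \<noteq> [] \<and> set xs \<subseteq> Y \<and> successively adj xs"

text \<open>The smallest possible homotopy: one interior vertex changes to an adjacent one. The condition
  concerns only that vertex and its neighbours \<open>p\<close> and \<open>q\<close>, so that moves can be performed inside any
  longer list.\<close>

inductive move :: "(int ^ 'n) set \<Rightarrow> (int ^ 'n) list \<Rightarrow> (int ^ 'n) list \<Rightarrow> bool" for Y where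
  move: "\<lbrakk>x \<in> Y; x' \<in> Y; adj x x'; adj p x; adj p x'; adj x q; adj x' q\<rbrakk>
    \<Longrightarrow> move Y (us @ p # x # q # vs) (us @ p # x' # q # vs)"

inductive stutter :: "'a list \<Rightarrow> 'a list \<Rightarrow> bool" where
  stutter: "stutter (us @ x # vs) (us @ x # x # vs)"

text \<open>Points and lengths may both change here, in contrast to \<open>move\<close>, which fixes the length. This is the
  combinatorial form of subdivision-based homotopy: \<open>deform_iff_repeat_each\<close> below makes the
  comparison.\<close>

definition deform :: "(int ^ 'n) set \<Rightarrow> (int ^ 'n) list \<Rightarrow> (int ^ 'n) list \<Rightarrow> bool" where
  "deform Y = equivclp (\<lambda>xs ys. move Y xs ys \<or> stutter xs ys)"

lemma move_sym: "move Y xs ys \<Longrightarrow> move Y ys xs"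
  by (auto elim!: move.cases intro!: move.move intro: adj_sym)

lemma moves_sym: "(move Y)\<^sup>*\<^sup>* xs ys \<Longrightarrow> (move Y)\<^sup>*\<^sup>* ys xs"
  by (metis move_sym sympD sympI symp_rtranclp)

lemma move_context: "move Y xs ys \<Longrightarrow> move Y (us @ xs @ vs) (us @ ys @ vs)"
proof (induction rule: move.induct)
  case (move x x' p q us' vs')
  then show ?case
    using move.intros[of x Y x' p q "us @ us'" "vs' @ vs"] by simp
qed

lemma moves_context: "(move Y)\<^sup>*\<^sup>* xs ys \<Longrightarrow> (move Y)\<^sup>*\<^sup>* (us @ xs @ vs) (us @ ys @ vs)"
  by (induction rule: rtranclp_induct) (auto intro: rtranclp.rtrancl_into_rtrancl move_context)

lemma stutter_context: "stutter xs ys \<Longrightarrow> stutter (us @ xs @ vs) (us @ ys @ vs)"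
proof (induction rule: stutter.induct)
  case (stutter us' x vs')
  then show ?case
    using stutter.intros[of "us @ us'" x "vs' @ vs"] by simp
qed

lemma move_invariants:
  assumes "move Y xs ys"
  shows "length ys = length xs" "hd ys = hd xs" "last ys = last xs" "walk Y ys \<longleftrightarrow> walk Y xs"
  using assms
  by (induction rule: move.induct)
    (auto simp: walk_def hd_append successively_append_iff successively_Cons split: if_splits)

lemma moves_invariants:
  assumes "(move Y)\<^sup>*\<^sup>* xs ys"
  shows "length ys = length xs \<and> hd ys = hd xs \<and> last ys = last xs \<and> (walk Y ys \<longleftrightarrow> walk Y xs)"
  using assms by (induction rule: rtranclp_induct) (auto simp: move_invariants)

lemma stutter_invariants:
  assumes "stutter xs ys"
  shows "hd ys = hd xs" "last ys = last xs" "walk Y ys \<longleftrightarrow> walk Y xs" "length ys = Suc (length xs)"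
    "xs \<noteq> []"
  using assms
  by (induction rule: stutter.induct)
    (auto simp: walk_def hd_append successively_append_iff successively_Cons split: if_splits)

lemma deform_refl [simp]: "deform Y xs xs"
  by (simp add: deform_def)

lemma deform_sym: "deform Y xs ys \<Longrightarrow> deform Y ys xs"
  unfolding deform_def by (rule equivclp_sym)

lemma deform_trans [trans]: "deform Y xs ys \<Longrightarrow> deform Y ys zs \<Longrightarrow> deform Y xs zs"
  unfolding deform_def by (rule equivclp_trans)

lemma move_deform: "move Y xs ys \<Longrightarrow> deform Y xs ys"
  unfolding deform_def by blast

lemma stutter_deform: "stutter xs ys \<Longrightarrow> deform Y xs ys"
  unfolding deform_def by blast

lemma moves_deform: "(move Y)\<^sup>*\<^sup>* xs ys \<Longrightarrow> deform Y xs ys"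
  by (induction rule: rtranclp_induct) (auto intro: deform_trans move_deform)

text \<open>Both generators are local, so deformation is a congruence for \<open>@\<close>. For subdivision-based
  homotopy itself this is not evident, because two factors of a product may need subdivisions
  at different rates.\<close>

lemma deform_context: "deform Y xs ys \<Longrightarrow> deform Y (us @ xs @ vs) (us @ ys @ vs)"
  unfolding deform_def
proof (induction rule: equivclp_induct)
  case (step y z)
  then show ?case
    by (blast intro: equivclp_into_equivclp move_context stutter_context)
qed simp

lemma deform_append:
  assumes "deform Y xs xs'" "deform Y ys ys'"
  shows "deform Y (xs @ ys) (xs' @ ys')"
proof -
  have "deform Y (xs @ ys) (xs' @ ys)"
    using deform_context[OF assms(1), of "[]" ys] by simp
  also have "deform Y (xs' @ ys) (xs' @ ys')"
    using deform_context[OF assms(2), of xs' "[]"] by simp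
  finally show ?thesis .
qed

lemma deform_stutter: "deform Y (us @ x # x # vs) (us @ x # vs)"
  by (rule deform_sym[OF stutter_deform[OF stutter]])

text \<open>Going to a neighbour and straight back can be undone: a move turns \<open>x, y, x\<close> into
  \<open>x, x, x\<close>, which is \<open>x\<close> with stutters.\<close>

lemma deform_detour:
  assumes "x \<in> Y" "y \<in> Y" "adj x y"
  shows "deform Y (us @ x # y # x # vs) (us @ x # vs)"
proof -
  have "deform Y (us @ x # y # x # vs) (us @ x # x # x # vs)"
    using assms by (intro move_deform move) (auto intro: adj_sym)
  also have "deform Y (us @ x # x # x # vs) (us @ x # x # vs)"
    by (rule deform_stutter)
  also have "deform Y (us @ x # x # vs) (us @ x # vs)"
    by (rule deform_stutter)
  finally show ?thesis .
qed

text \<open>The list \<open>rev xs @ xs\<close> runs out and back over the same points, so it contracts from the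
  middle: the innermost part is a detour \<open>y, x, y\<close> in which \<open>x\<close> is
  repeated.\<close>

lemma deform_rev_append:
  assumes "walk Y xs"
  shows "deform Y (rev xs @ xs) [last xs]"
  using assms
proof (induction xs rule: induct_list012)
  case (2 x)
  then show ?case using deform_stutter[of Y "[]" x "[]"] by simp
next
  case (3 x y xs)
  have "deform Y (rev (x # y # xs) @ x # y # xs) ((rev xs @ [y, x]) @ x # y # xs)"
    by simp
  also have "deform Y \<dots> (rev xs @ y # x # y # xs)"
    using deform_stutter[of Y "rev xs @ [y]" x "y # xs"] by simp
  also have "deform Y \<dots> (rev xs @ y # xs)"
    using "3.prems" by (intro deform_detour) (auto simp: walk_def intro: adj_sym)
  also have "deform Y \<dots> (rev (y # xs) @ y # xs)"
    using deform_sym[OF deform_stutter[of Y "rev xs" y xs]] by simp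
  also have "deform Y \<dots> [last (y # xs)]"
    using "3.prems" by (intro "3.IH"(2)) (auto simp: walk_def)
  finally show ?case by simp
qed (simp add: walk_def)

lemma walk_rev [simp]: "walk Y (rev xs) \<longleftrightarrow> walk Y xs"
  by (auto simp: walk_def intro: successively_mono adj_sym)

lemma walk_append:
  "walk Y xs \<Longrightarrow> walk Y ys \<Longrightarrow> last xs = hd ys \<Longrightarrow> walk Y (xs @ ys)"
  by (auto simp: walk_def successively_append_iff)

lemma deform_append_rev:
  assumes "walk Y xs"
  shows "deform Y (xs @ rev xs) [hd xs]"
  using deform_rev_append[of Y "rev xs"] assms by (simp add: last_rev)

lemma deform_hd_append: "xs \<noteq> [] \<Longrightarrow> deform Y ([hd xs] @ xs) xs"
  using deform_stutter[of Y "[]" "hd xs" "tl xs"] by simp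

lemma deform_append_last: "xs \<noteq> [] \<Longrightarrow> deform Y (xs @ [last xs]) xs"
  using deform_stutter[of Y "butlast xs" "last xs" "[]"]
  by (cases xs rule: rev_cases) auto

section \<open>Normal form: all repetitions at the end\<close>

text \<open>A repetition can travel to the right end of a walk, because \<open>x, x, y\<close> and \<open>x, y, y\<close> differ by one
  move. Hence the position of a stutter does not matter up to homotopy of fixed length.\<close>

lemma moves_shift_stutter:
  assumes "walk Y (us @ x # vs)"
  shows "(move Y)\<^sup>*\<^sup>* (us @ x # x # vs) (us @ x # vs @ [last (x # vs)])"
  using assms
proof (induction vs arbitrary: us x)
  case (Cons y vs)
  then have *: "x \<in> Y" "y \<in> Y" "adj x y"
    by (auto simp: walk_def successively_append_iff)
  have "move Y (us @ x # x # y # vs) (us @ x # y # y # vs)"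
    using * by (intro move) auto
  also have "(move Y)\<^sup>*\<^sup>* (us @ x # y # y # vs) (us @ x # y # vs @ [last (y # vs)])"
    using Cons.IH[of "us @ [x]" y] Cons.prems by simp
  finally show ?case by simp
qed simp

definition pad :: "nat \<Rightarrow> 'a list \<Rightarrow> 'a list" where
  "pad k xs = xs @ replicate k (last xs)"

lemma length_pad [simp]: "length (pad k xs) = length xs + k"
  by (simp add: pad_def)

lemma pad_0 [simp]: "pad 0 xs = xs"
  by (simp add: pad_def)

lemma pad_pad [simp]: "xs \<noteq> [] \<Longrightarrow> pad k (pad l xs) = pad (l + k) xs"
  by (cases l) (auto simp: pad_def replicate_add)

lemma moves_pad: "(move Y)\<^sup>*\<^sup>* xs ys \<Longrightarrow> (move Y)\<^sup>*\<^sup>* (pad k xs) (pad k ys)"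
  using moves_context[of Y xs ys "[]" "replicate k (last xs)"] moves_invariants[of Y xs ys]
  by (simp add: pad_def)

lemma stutter_moves_pad:
  assumes "stutter xs ys" "walk Y xs"
  shows "(move Y)\<^sup>*\<^sup>* ys (pad 1 xs)"
  using assms
  by (induction rule: stutter.induct) (use moves_shift_stutter in \<open>force simp: pad_def\<close>)

text \<open>Two walks of the same length that are obtained from \<open>xs\<close> by stuttering are therefore homotopic:
  both are homotopic to \<open>xs\<close> with its endpoint repeated.\<close>

lemma stutters_moves_pad:
  assumes "stutter\<^sup>*\<^sup>* xs ys" "walk Y xs"
  shows "walk Y ys \<and> length xs \<le> length ys \<and> (move Y)\<^sup>*\<^sup>* ys (pad (length ys - length xs) xs)"
  using assms(1)
proof (induction rule: rtranclp_induct)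
  case (step ys zs)
  have len: "length zs = Suc (length ys)" and walk: "walk Y zs"
    using stutter_invariants[OF step.hyps(2)] step.IH by auto
  have "(move Y)\<^sup>*\<^sup>* zs (pad 1 ys)"
    using step stutter_moves_pad by blast
  also have "(move Y)\<^sup>*\<^sup>* (pad 1 ys) (pad 1 (pad (length ys - length xs) xs))"
    using step moves_pad by blast
  finally show ?case
    using step.IH assms(2) len walk by (simp add: walk_def Suc_diff_le)
qed (simp add: assms)

text \<open>Every deformation becomes a homotopy of fixed length once both walks wait long enough at their
  endpoint. A chain of generators is handled one at a time, and the waiting times add up along
  the chain.\<close>

lemma deform_moves_pad:
  assumes "deform Y xs ys" "walk Y xs"
  shows "walk Y ys \<and> hd ys = hd xs \<and> last ys = last xs \<and> (\<exists>i j. (move Y)\<^sup>*\<^sup>* (pad i xs) (pad j ys))"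
  using assms(1) unfolding deform_def
proof (induction rule: equivclp_induct)
  case base
  then show ?case using assms by blast
next
  case (step ys zs)
  then obtain i j where ij: "(move Y)\<^sup>*\<^sup>* (pad i xs) (pad j ys)" by blast
  have inv: "walk Y zs" "hd zs = hd ys" "last zs = last ys"
    using step move_invariants stutter_invariants by metis+
  have ne: "xs \<noteq> []" "ys \<noteq> []" "zs \<noteq> []"
    using assms step inv by (auto simp: walk_def)
  have "\<exists>k l. (move Y)\<^sup>*\<^sup>* (pad k ys) (pad l zs)"
  proof -
    have "(move Y)\<^sup>*\<^sup>* (pad 0 ys) (pad 0 zs)" if "move Y ys zs \<or> move Y zs ys"
      using that by (auto intro: move_sym)
    moreover have "(move Y)\<^sup>*\<^sup>* (pad 1 ys) (pad 0 zs)" if "stutter ys zs"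
      using stutter_moves_pad[OF that, of Y] step by (simp add: moves_sym)
    moreover have "(move Y)\<^sup>*\<^sup>* (pad 0 ys) (pad 1 zs)" if "stutter zs ys"
      using stutter_moves_pad[OF that, of Y] inv by simp
    ultimately show ?thesis using step.hyps by blast
  qed
  then obtain k l where kl: "(move Y)\<^sup>*\<^sup>* (pad k ys) (pad l zs)" by blast
  have "(move Y)\<^sup>*\<^sup>* (pad (i + k) xs) (pad (j + k) ys)"
    using moves_pad[OF ij, of k] ne by simp
  also have "(move Y)\<^sup>*\<^sup>* (pad (j + k) ys) (pad (l + j) zs)"
    using moves_pad[OF kl, of j] ne by (simp add: add.commute)
  finally show ?case using inv step.IH by auto
qed

section \<open>Deformation is homotopy after subdivision\<close>

definition repeat_each :: "nat \<Rightarrow> 'a list \<Rightarrow> 'a list" where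
  "repeat_each k xs = concat (map (replicate k) xs)"

lemma repeat_each_simps [simp]:
  "repeat_each k [] = []" "repeat_each k (x # xs) = replicate k x @ repeat_each k xs"
  by (simp_all add: repeat_each_def)

lemma length_repeat_each [simp]: "length (repeat_each k xs) = k * length xs"
  by (induction xs) auto

lemma stutters_context: "stutter\<^sup>*\<^sup>* xs ys \<Longrightarrow> stutter\<^sup>*\<^sup>* (us @ xs @ vs) (us @ ys @ vs)"
  by (induction rule: rtranclp_induct) (auto intro: rtranclp.rtrancl_into_rtrancl stutter_context)

lemma stutters_replicate: "stutter\<^sup>*\<^sup>* [x] (replicate (Suc k) x)"
proof (induction k)
  case (Suc k)
  then show ?case
    using stutter[of "[]" x "replicate k x"] by (simp add: rtranclp.rtrancl_into_rtrancl)
qed simp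

lemma stutters_repeat_each: "k \<ge> 1 \<Longrightarrow> stutter\<^sup>*\<^sup>* xs (repeat_each k xs)"
proof (induction xs)
  case (Cons x xs)
  have "stutter\<^sup>*\<^sup>* (x # xs) (x # repeat_each k xs)"
    using stutters_context[OF Cons.IH, of "[x]" "[]"] Cons.prems by simp
  also have "stutter\<^sup>*\<^sup>* (x # repeat_each k xs) (replicate k x @ repeat_each k xs)"
    using stutters_context[OF stutters_replicate[of x "k - 1"], of "[]" "repeat_each k xs"] Cons.prems
    by simp
  finally show ?case by simp
qed simp

lemma deform_repeat_each: "k \<ge> 1 \<Longrightarrow> deform Y xs (repeat_each k xs)"
proof -
  have "deform Y xs ys" if "stutter\<^sup>*\<^sup>* xs ys" for ys
    using that by (induction rule: rtranclp_induct) (auto intro: deform_trans stutter_deform)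
  then show "k \<ge> 1 \<Longrightarrow> ?thesis" using stutters_repeat_each by blast
qed

text \<open>Subdividing is a special stuttering, which gives one direction. For the other, subdivisions of
  \<open>xs\<close> and \<open>ys\<close> to a common length are homotopic to padded versions of \<open>xs\<close> and \<open>ys\<close>, and if
  the common length is large, then the padding is long enough for \<open>deform_moves_pad\<close>.\<close>

lemma deform_iff_repeat_each:
  assumes "walk Y xs" "walk Y ys"
  shows "deform Y xs ys \<longleftrightarrow> (\<exists>k\<ge>1. \<exists>l\<ge>1. k * length xs = l * length ys \<and>
      (move Y)\<^sup>*\<^sup>* (repeat_each k xs) (repeat_each l ys))"
proof
  assume "deform Y xs ys"
  then obtain i j where ij: "(move Y)\<^sup>*\<^sup>* (pad i xs) (pad j ys)"
    using deform_moves_pad assms(1) by blast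
  define m n where "m = length xs" and "n = length ys"
  have mn: "m \<ge> 1" "n \<ge> 1" "m + i = n + j"
    using assms moves_invariants[OF ij] by (auto simp: walk_def m_def n_def Suc_leI)
  \<comment> \<open>The factor \<open>i + 1\<close> makes the common length \<open>m * n * (i + 1)\<close> at least \<open>m + i\<close>, the length
    at which the padded walks are homotopic.\<close>
  define k l where "k = n * (i + 1)" and "l = m * (i + 1)"
  have kl: "k \<ge> 1" "l \<ge> 1" "k * m = l * n"
    using mn(1,2) by (simp_all add: k_def l_def algebra_simps)
  show "\<exists>k\<ge>1. \<exists>l\<ge>1. k * length xs = l * length ys \<and>
      (move Y)\<^sup>*\<^sup>* (repeat_each k xs) (repeat_each l ys)"
  proof (intro exI conjI)
    have "m * (i + 1) * 1 \<le> m * (i + 1) * n"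
      using mn by (intro mult_left_mono) auto
    then have "m + i \<le> k * m"
      using mn by (cases m) (auto simp: k_def algebra_simps)
    then have d: "k * m - m = i + (k * m - (m + i))" "l * n - n = j + (k * m - (m + i))"
      using mn kl by auto
    have "(move Y)\<^sup>*\<^sup>* (repeat_each k xs) (pad (k * m - m) xs)"
      using stutters_moves_pad[OF stutters_repeat_each[OF kl(1)] assms(1)] by (simp add: m_def)
    also have "pad (k * m - m) xs = pad (k * m - (m + i)) (pad i xs)"
      using assms d by (simp add: walk_def)
    also have "(move Y)\<^sup>*\<^sup>* \<dots> (pad (k * m - (m + i)) (pad j ys))"
      using ij by (rule moves_pad)
    also have "pad (k * m - (m + i)) (pad j ys) = pad (l * n - n) ys"
      using assms d by (simp add: walk_def)
    also have "(move Y)\<^sup>*\<^sup>* \<dots> (repeat_each l ys)"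
      using stutters_moves_pad[OF stutters_repeat_each[OF kl(2)] assms(2)]
      by (simp add: n_def moves_sym)
    finally show "(move Y)\<^sup>*\<^sup>* (repeat_each k xs) (repeat_each l ys)" .
  qed (use kl in \<open>simp_all add: m_def n_def\<close>)
next
  assume "\<exists>k\<ge>1. \<exists>l\<ge>1. k * length xs = l * length ys \<and>
      (move Y)\<^sup>*\<^sup>* (repeat_each k xs) (repeat_each l ys)"
  then obtain k l where "k \<ge> 1" "l \<ge> 1" "(move Y)\<^sup>*\<^sup>* (repeat_each k xs) (repeat_each l ys)"
    by blast
  then show "deform Y xs ys"
    by (meson deform_repeat_each deform_sym deform_trans moves_deform)
qed

section \<open>Homotopies on rectangles are sequences of moves\<close>

text \<open>Two consecutive rows of a homotopy are connected by moves that replace the vertices of the old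
  row by those of the new one from left to right. The intermediate lists are walks since the
  diagonals \<open>ys ! i\<close>, \<open>xs ! Suc i\<close> are adjacent in a homotopy; only one of the two diagonal
  directions occurs. The first vertex \<open>p\<close> is split off because in the induction it
  stands for the vertex that was replaced last.\<close>

lemma moves_if_rows_adjacent:
  assumes "length xs = length ys" "walk Y (p # xs)" "walk Y (p # ys)" "last (p # xs) = last (p # ys)"
    and "\<And>i. i < length xs \<Longrightarrow> adj (xs ! i) (ys ! i)"
    and "\<And>i. Suc i < length xs \<Longrightarrow> adj (ys ! i) (xs ! Suc i)"
  shows "(move Y)\<^sup>*\<^sup>* (p # xs) (p # ys)"
  using assms
proof (induction xs ys arbitrary: p rule: list_induct2)
  case (Cons x xs y ys)
  show ?case
  proof (cases xs)
    case Nil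
    then show ?thesis using Cons by simp
  next
    case (Cons q xs')
    have xy: "adj x y" "adj y q"
      using Cons.prems(4)[of 0] Cons.prems(5)[of 0] Cons by auto
    have "move Y (p # x # q # xs') (p # y # q # xs')"
      using xy move[of x Y y p q "[]" xs'] Cons.prems Cons by (auto simp: walk_def)
    moreover have "(move Y)\<^sup>*\<^sup>* (y # xs) (y # ys)"
    proof (rule Cons.IH)
      show "adj (xs ! i) (ys ! i)" if "i < length xs" for i
        using Cons.prems(4)[of "Suc i"] that by simp
      show "adj (ys ! i) (xs ! Suc i)" if "Suc i < length xs" for i
        using Cons.prems(5)[of "Suc i"] that by simp
    qed (use xy Cons Cons.prems Cons.hyps in \<open>auto simp: walk_def split: if_splits\<close>)
    then have "(move Y)\<^sup>*\<^sup>* (p # y # xs) (p # y # ys)"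
      using moves_context[of Y "y # xs" "y # ys" "[p]" "[]"] by simp
    ultimately show ?thesis
      using Cons by (simp add: converse_rtranclp_into_rtranclp)
  qed
qed simp

lemma walk_nth_adj:
  assumes "walk Y xs" "i < length xs" "j < length xs" "adj_interval i j"
  shows "adj (xs ! i) (xs ! j)"
proof -
  have "j = i \<or> j = Suc i \<or> i = Suc j"
    using assms(4) by (auto simp: adj_interval_def)
  then show ?thesis
    using assms(1-3) by (auto simp: walk_def successively_conv_nth intro: adj_sym)
qed

lemma walkI_nth:
  assumes "xs \<noteq> []" "\<And>i. i < length xs \<Longrightarrow> xs ! i \<in> Y"
    "\<And>i. Suc i < length xs \<Longrightarrow> adj (xs ! i) (xs ! Suc i)"
  shows "walk Y xs"
  using assms by (auto simp: walk_def successively_conv_nth set_conv_nth)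

text \<open>Conversely, the lists before and after a move satisfy all adjacencies, diagonal ones included, that
  two consecutive rows of a homotopy must satisfy.\<close>

lemma move_nth_adj:
  assumes "move Y xs ys" "walk Y xs" "i < length xs" "j < length xs" "adj_interval i j"
  shows "adj (xs ! i) (ys ! j)"
  using assms
proof (induction rule: move.induct)
  case (move x x' p q us vs)
  let ?xs = "us @ p # x # q # vs" and ?n = "Suc (length us)"
  have upd: "us @ p # x' # q # vs = ?xs[?n := x']"
    by (simp add: list_update_append)
  show ?case
  proof (cases "j = ?n")
    case True
    then have "i = length us \<or> i = ?n \<or> i = Suc ?n"
      using move.prems(4) by (auto simp: adj_interval_def)
    then show ?thesis
      using True move.hyps by (auto simp: nth_append intro: adj_sym)
  next
    case False
    then show ?thesis
      using walk_nth_adj[OF move.prems] by (simp add: upd)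
  qed
qed

text \<open>Each move contributes one row to the rectangle. The empty sequence of moves needs the constant
  homotopy of height 1, as the height has to be positive.\<close>

lemma moves_imp_homotopy:
  assumes "(move Y)\<^sup>*\<^sup>* xs ys" "walk Y xs" "length xs = Suc M"
  shows "\<exists>R\<ge>1. \<exists>H :: nat \<times> nat \<Rightarrow> int ^ 'n.
        digitally_continuous adj_rectangle ({..M} \<times> {..R}) adj Y H \<and>
        (\<forall>s\<le>M. H (s, 0) = xs ! s \<and> H (s, R) = ys ! s) \<and>
        (\<forall>t\<le>R. H (0, t) = hd xs \<and> H (M, t) = last xs)"
  using assms(1)
proof (induction rule: rtranclp_induct)
  case base
  have "digitally_continuous adj_rectangle ({..M} \<times> {..1}) adj Y (\<lambda>p. xs ! fst p)"
    using assms(2,3) walk_nth_adj[OF assms(2)]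
    by (auto simp: digitally_continuous_def adj_rectangle_def walk_def less_Suc_eq_le)
  moreover have "hd xs = xs ! 0" "last xs = xs ! M"
    using assms by (auto simp: walk_def hd_conv_nth last_conv_nth)
  ultimately show ?case
    by (intro exI[of _ 1] conjI exI[of _ "\<lambda>p. xs ! fst p"]) simp_all
next
  case (step ys zs)
  then obtain R H where "R \<ge> 1"
    and cont: "digitally_continuous adj_rectangle ({..M} \<times> {..R}) adj Y H"
    and H: "\<forall>s\<le>M. H (s, 0) = xs ! s \<and> H (s, R) = ys ! s"
    and ends: "\<forall>t\<le>R. H (0, t) = hd xs \<and> H (M, t) = last xs"
    by blast
  have ys: "walk Y ys" "length ys = Suc M"
    using moves_invariants[OF step.hyps(1)] assms by auto
  have zs: "walk Y zs" "length zs = Suc M" "hd zs = hd xs" "last zs = last xs"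
    using move_invariants[OF step.hyps(2)] moves_invariants[OF step.hyps(1)] assms by auto
  have zs_ends: "zs ! 0 = hd xs" "zs ! M = last xs"
    using zs hd_conv_nth[of zs] last_conv_nth[of zs] by (auto simp: walk_def)
  define K where "K = (\<lambda>(s, t). if t \<le> R then H (s, t) else zs ! s)"
  have "digitally_continuous adj_rectangle ({..M} \<times> {..Suc R}) adj Y K"
    unfolding digitally_continuous_def
  proof (intro conjI ballI impI)
    have "H (s, t) \<in> Y" if "s \<le> M" "t \<le> R" for s t
      using cont that unfolding digitally_continuous_def by blast
    moreover have "zs ! s \<in> Y" if "s \<le> M" for s
      using zs(1,2) that nth_mem[of s zs] by (auto simp: walk_def)
    ultimately show "K \<in> {..M} \<times> {..Suc R} \<rightarrow> Y"
      by (auto simp: K_def)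
  next
    fix a b
    assume "a \<in> {..M} \<times> {..Suc R}" "b \<in> {..M} \<times> {..Suc R}" "adj_rectangle a b"
    then obtain s t s' t' where ab: "a = (s, t)" "b = (s', t')" "s \<le> M" "s' \<le> M"
        "t \<le> Suc R" "t' \<le> Suc R" "adj_interval s s'" "adj_interval t t'"
      by (cases a; cases b) (auto simp: adj_rectangle_def)
    have s: "s < Suc M" "s' < Suc M" "adj_interval s' s"
      using ab by (auto simp: adj_interval_def)
    consider "t \<le> R" "t' \<le> R" | "t = Suc R" "t' = Suc R" | "t = R" "t' = Suc R" | "t = Suc R" "t' = R"
      using ab by (force simp: adj_interval_def)
    then show "adj (K a) (K b)"
    proof cases
      case 1
      then show ?thesis
        using cont ab by (auto simp: K_def digitally_continuous_def adj_rectangle_def)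
    next
      case 2
      then show ?thesis
        using ab s zs walk_nth_adj[of Y zs s s'] by (simp add: K_def)
    next
      case 3
      then show ?thesis
        using ab s ys H move_nth_adj[OF step.hyps(2), of s s'] by (simp add: K_def)
    next
      case 4
      then show ?thesis
        using ab s ys H move_nth_adj[OF step.hyps(2), of s' s] by (simp add: K_def adj_sym)
    qed
  qed
  moreover have "\<forall>s\<le>M. K (s, 0) = xs ! s \<and> K (s, Suc R) = zs ! s"
    using H by (simp add: K_def)
  moreover have "\<forall>t\<le>Suc R. K (0, t) = hd xs \<and> K (M, t) = last xs"
    using ends zs_ends by (simp add: K_def)
  ultimately show ?case
    by (intro exI[of _ "Suc R"] conjI exI[of _ K]) simp_all
qed

lemma homotopy_imp_moves:
  fixes H :: "nat \<times> nat \<Rightarrow> int ^ 'n"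
  assumes cont: "digitally_continuous adj_rectangle ({..M} \<times> {..R}) adj Y H"
    and ends: "\<forall>t\<le>R. H (0, t) = y0 \<and> H (M, t) = y0"
  shows "(move Y)\<^sup>*\<^sup>* (map (\<lambda>s. H (s, 0)) [0..<Suc M]) (map (\<lambda>s. H (s, R)) [0..<Suc M])"
proof -
  define row where "row t = map (\<lambda>s. H (s, t)) [0..<Suc M]" for t
  define tail where "tail t = map (\<lambda>s. H (Suc s, t)) [0..<M]" for t
  have adj: "adj (H (s, t)) (H (s', t'))"
    if "s \<le> M" "s' \<le> M" "t \<le> R" "t' \<le> R" "adj_interval s s'" "adj_interval t t'" for s t s' t'
    using cont that by (auto simp: digitally_continuous_def adj_rectangle_def)
  have inY: "H (s, t) \<in> Y" if "s \<le> M" "t \<le> R" for s t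
    using cont that by (auto simp: digitally_continuous_def)
  have row: "row t = y0 # tail t" if "t \<le> R" for t
    using ends that by (simp add: row_def tail_def upt_conv_Cons map_Suc_upt[symmetric] del: upt_Suc)
  have walk: "walk Y (row t)" if "t \<le> R" for t
    using that by (intro walkI_nth) (auto simp: row_def inY nth_append adj_interval_def intro!: adj simp del: upt_Suc)
  have last: "last (row t) = y0" if "t \<le> R" for t
    using ends that by (simp add: row_def)
  have "(move Y)\<^sup>*\<^sup>* (row 0) (row t)" if "t \<le> R" for t
    using that
  proof (induction t)
    case (Suc t)
    have "(move Y)\<^sup>*\<^sup>* (y0 # tail t) (y0 # tail (Suc t))"
    proof (rule moves_if_rows_adjacent)
      show "length (tail t) = length (tail (Suc t))" by (simp add: tail_def)
    next
      fix i assume "i < length (tail t)"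
      then show "adj (tail t ! i) (tail (Suc t) ! i)"
        using Suc.prems by (auto simp: tail_def adj_interval_def intro!: adj)
    next
      fix i assume "Suc i < length (tail t)"
      then show "adj (tail (Suc t) ! i) (tail t ! Suc i)"
        using Suc.prems by (auto simp: tail_def adj_interval_def intro!: adj)
    qed (use walk[of t] walk[of "Suc t"] last[of t] last[of "Suc t"] row[of t] row[of "Suc t"]
          Suc.prems in simp_all)
    then show ?case
      using Suc row[of t] row[of "Suc t"] by simp
  qed simp
  then show ?thesis by (auto simp: row_def)
qed

section \<open>Digital paths and their lists of points\<close>

definition points :: "'n dpath \<Rightarrow> (int ^ 'n) list" where
  "points = (\<lambda>(N, \<gamma>). map \<gamma> [0..<Suc N])"

lemma length_points [simp]: "length (points \<alpha>) = Suc (fst \<alpha>)"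
  by (simp add: points_def split: prod.split)

lemma points_not_Nil [simp]: "points \<alpha> \<noteq> []"
  by (simp add: points_def split: prod.split)

lemma nth_points [simp]: "i \<le> N \<Longrightarrow> points (N, \<gamma>) ! i = \<gamma> i"
  by (simp add: points_def del: upt_Suc)

lemma hd_points [simp]: "hd (points (N, \<gamma>)) = \<gamma> 0"
  by (simp add: hd_conv_nth)

lemma last_points [simp]: "last (points (N, \<gamma>)) = \<gamma> N"
  by (simp add: last_conv_nth)

lemma digital_path_iff_walk:
  "digital_path Y (N, \<gamma>) \<longleftrightarrow> \<gamma> \<in> extensional {..N} \<and> walk Y (points (N, \<gamma>))"
proof -
  have "digitally_continuous adj_interval {..N} adj Y \<gamma> \<longleftrightarrow> walk Y (points (N, \<gamma>))"
  proof
    assume "digitally_continuous adj_interval {..N} adj Y \<gamma>"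
    then show "walk Y (points (N, \<gamma>))"
      by (intro walkI_nth) (auto simp: digitally_continuous_def adj_interval_def)
  next
    assume w: "walk Y (points (N, \<gamma>))"
    then have "\<gamma> i \<in> Y" if "i \<le> N" for i
      using that nth_mem[of i "points (N, \<gamma>)"] by (auto simp: walk_def)
    moreover have "adj (\<gamma> i) (\<gamma> j)" if "i \<le> N" "j \<le> N" "adj_interval i j" for i j
      using walk_nth_adj[OF w _ _ that(3)] that by simp
    ultimately show "digitally_continuous adj_interval {..N} adj Y \<gamma>"
      by (auto simp: digitally_continuous_def)
  qed
  then show ?thesis by (simp add: digital_path_def)
qed

lemma based_loops_iff:
  "\<alpha> \<in> based_loops Y y0 \<longleftrightarrow> fst \<alpha> \<ge> 1 \<and> snd \<alpha> \<in> extensional {..fst \<alpha>} \<and>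
     walk Y (points \<alpha>) \<and> hd (points \<alpha>) = y0 \<and> last (points \<alpha>) = y0"
  by (cases \<alpha>) (auto simp: based_loops_def digital_path_iff_walk)

text \<open>The endpoints stay at the basepoint throughout because a move changes interior vertices only.\<close>

lemma based_homotopic_iff_moves:
  assumes "\<alpha> \<in> based_loops Y y0" "\<beta> \<in> based_loops Y y0"
  shows "based_homotopic Y y0 \<alpha> \<beta> \<longleftrightarrow> (move Y)\<^sup>*\<^sup>* (points \<alpha>) (points \<beta>)"
proof
  assume "based_homotopic Y y0 \<alpha> \<beta>"
  then obtain M a b R H where eq: "\<alpha> = (M, a)" "\<beta> = (M, b)"
    and cont: "digitally_continuous adj_rectangle ({..M} \<times> {..R}) adj Y H"
    and H: "\<forall>s\<le>M. H (s, 0) = a s \<and> H (s, R) = b s"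
    and ends: "\<forall>t\<le>R. H (0, t) = y0 \<and> H (M, t) = y0"
    unfolding based_homotopic_def by fast
  have "points \<alpha> = map (\<lambda>s. H (s, 0)) [0..<Suc M]" "points \<beta> = map (\<lambda>s. H (s, R)) [0..<Suc M]"
    using H by (auto simp: points_def eq simp del: upt_Suc)
  then show "(move Y)\<^sup>*\<^sup>* (points \<alpha>) (points \<beta>)"
    using homotopy_imp_moves[OF cont ends] by simp
next
  assume m: "(move Y)\<^sup>*\<^sup>* (points \<alpha>) (points \<beta>)"
  obtain M a N b where eq: "\<alpha> = (M, a)" "\<beta> = (N, b)"
    by (metis surj_pair)
  have "N = M"
    using moves_invariants[OF m] by (simp add: eq)
  then show "based_homotopic Y y0 \<alpha> \<beta>"
    using assms moves_imp_homotopy[OF m, of M]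
    by (auto simp: eq based_homotopic_def based_loops_iff)
qed

lemma nth_repeat_each: "i < k * length xs \<Longrightarrow> repeat_each k xs ! i = xs ! (i div k)"
proof (induction xs arbitrary: i)
  case (Cons x xs)
  show ?case
  proof (cases "i < k")
    case True
    then show ?thesis by (simp add: nth_append)
  next
    case False
    moreover have "k > 0" using Cons.prems by (cases k) auto
    ultimately show ?thesis
      using Cons.IH[of "i - k"] Cons.prems by (simp add: nth_append le_div_geq)
  qed
qed simp

lemma fst_subdivide: "k \<ge> 1 \<Longrightarrow> Suc (fst (subdivide k \<alpha>)) = k * Suc (fst \<alpha>)"
  by (cases \<alpha>) (simp add: subdivide_def)

lemma points_subdivide:
  assumes "k \<ge> 1"
  shows "points (subdivide k \<alpha>) = repeat_each k (points \<alpha>)"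
proof (rule nth_equalityI)
  show "length (points (subdivide k \<alpha>)) = length (repeat_each k (points \<alpha>))"
    using fst_subdivide[OF assms] by simp
  fix i assume "i < length (points (subdivide k \<alpha>))"
  then have i: "i < k * Suc (fst \<alpha>)"
    using fst_subdivide[OF assms, of \<alpha>] by simp
  obtain N a where \<alpha>: "\<alpha> = (N, a)" by fastforce
  have "i div k < Suc N"
    using i assms by (simp add: \<alpha> div_less_iff_less_mult mult.commute)
  moreover have "i \<le> k * N + k - 1" using i by (simp add: \<alpha>)
  ultimately show "points (subdivide k \<alpha>) ! i = repeat_each k (points \<alpha>) ! i"
    using i by (simp add: \<alpha> nth_repeat_each subdivide_def compose_def rho_def)
qed

lemma subdivide_based_loops:
  assumes "k \<ge> 1" "\<alpha> \<in> based_loops Y y0"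
  shows "subdivide k \<alpha> \<in> based_loops Y y0"
proof -
  have "deform Y (points \<alpha>) (repeat_each k (points \<alpha>))"
    using assms(1) by (rule deform_repeat_each)
  note deform_moves_pad[OF this]
  moreover have "Suc (fst (subdivide k \<alpha>)) \<ge> Suc (fst \<alpha>)"
    using fst_subdivide[OF assms(1), of \<alpha>] mult_le_mono1[OF assms(1), of "Suc (fst \<alpha>)"] by simp
  moreover have "snd (subdivide k \<alpha>) \<in> extensional {..fst (subdivide k \<alpha>)}"
    by (cases \<alpha>) (simp add: subdivide_def compose_def)
  ultimately show ?thesis
    using assms by (auto simp: based_loops_iff points_subdivide)
qed

text \<open>From here on all identities between loop classes are statements about lists. In
  particular transitivity of subdivision-based homotopy is now immediate.\<close>

lemma subdivision_homotopy_iff_deform: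
  "(\<alpha>, \<beta>) \<in> subdivision_homotopy Y y0 \<longleftrightarrow>
     \<alpha> \<in> based_loops Y y0 \<and> \<beta> \<in> based_loops Y y0 \<and> deform Y (points \<alpha>) (points \<beta>)"
proof (cases "\<alpha> \<in> based_loops Y y0 \<and> \<beta> \<in> based_loops Y y0")
  case True
  then have loops: "\<alpha> \<in> based_loops Y y0" "\<beta> \<in> based_loops Y y0"
    and walks: "walk Y (points \<alpha>)" "walk Y (points \<beta>)"
    by (auto simp: based_loops_iff)
  have "based_homotopic Y y0 (subdivide k \<alpha>) (subdivide l \<beta>) \<longleftrightarrow>
      (move Y)\<^sup>*\<^sup>* (repeat_each k (points \<alpha>)) (repeat_each l (points \<beta>))"
    if "k \<ge> 1" "l \<ge> 1" for k l
    using that loops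
    by (simp add: based_homotopic_iff_moves subdivide_based_loops points_subdivide)
  then have "deform Y (points \<alpha>) (points \<beta>) \<longleftrightarrow>
      (\<exists>k\<ge>1. \<exists>l\<ge>1. k * (fst \<alpha> + 1) = l * (fst \<beta> + 1) \<and>
        based_homotopic Y y0 (subdivide k \<alpha>) (subdivide l \<beta>))"
    unfolding deform_iff_repeat_each[OF walks] length_points by (metis Suc_eq_plus1)
  then show ?thesis
    using True by (cases \<alpha>; cases \<beta>) (simp add: subdivision_homotopy_def)
qed (auto simp: subdivision_homotopy_def)

section \<open>The fundamental group\<close>

lemma loop_class_eq_Collect:
  "\<alpha> \<in> based_loops Y y0 \<Longrightarrow>
    loop_class Y y0 \<alpha> = {\<beta> \<in> based_loops Y y0. deform Y (points \<alpha>) (points \<beta>)}"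
  by (auto simp: loop_class_def subdivision_homotopy_iff_deform)

lemma loop_class_eq_iff:
  assumes "\<alpha> \<in> based_loops Y y0" "\<beta> \<in> based_loops Y y0"
  shows "loop_class Y y0 \<alpha> = loop_class Y y0 \<beta> \<longleftrightarrow> deform Y (points \<alpha>) (points \<beta>)"
  using assms by (auto simp: loop_class_eq_Collect intro: deform_sym deform_trans)

lemma carrier_fundamental_group:
  "carrier (fundamental_group Y y0) = loop_class Y y0 ` based_loops Y y0"
  by (auto simp: fundamental_group_def quotient_def loop_class_def)

lemma points_concat [simp]: "points (\<alpha> \<cdot> \<beta>) = points \<alpha> @ points \<beta>"
proof (rule nth_equalityI)
  fix i assume "i < length (points (\<alpha> \<cdot> \<beta>))"
  then show "points (\<alpha> \<cdot> \<beta>) ! i = (points \<alpha> @ points \<beta>) ! i"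
    by (cases \<alpha>; cases \<beta>) (auto simp: path_concat_def nth_append)
qed (simp add: path_concat_def split: prod.split)

lemma points_reverse [simp]: "points (path_reverse \<alpha>) = rev (points \<alpha>)"
proof (rule nth_equalityI)
  fix i assume "i < length (points (path_reverse \<alpha>))"
  then show "points (path_reverse \<alpha>) ! i = rev (points \<alpha>) ! i"
    by (cases \<alpha>) (auto simp: path_reverse_def rev_nth)
qed (simp add: path_reverse_def split: prod.split)

lemma concat_extensional: "snd (\<alpha> \<cdot> \<beta>) \<in> extensional {..fst (\<alpha> \<cdot> \<beta>)}"
  by (simp add: path_concat_def split: prod.split)

lemma fst_concat: "fst (\<alpha> \<cdot> \<beta>) = fst \<alpha> + fst \<beta> + 1"
  by (simp add: path_concat_def split: prod.split)

lemma concat_based_loops: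
  assumes "walk Y (points \<alpha>)" "walk Y (points \<beta>)" "last (points \<alpha>) = hd (points \<beta>)"
    "hd (points \<alpha>) = y0" "last (points \<beta>) = y0"
  shows "\<alpha> \<cdot> \<beta> \<in> based_loops Y y0"
  using assms concat_extensional[of \<alpha> \<beta>] by (simp add: based_loops_iff fst_concat walk_append)

lemma reverse_based_loops:
  "\<alpha> \<in> based_loops Y y0 \<Longrightarrow> path_reverse \<alpha> \<in> based_loops Y y0"
  by (cases \<alpha>) (use points_reverse[of \<alpha>] in \<open>auto simp: based_loops_iff hd_rev last_rev path_reverse_def\<close>)

lemma constant_based_loops: "y0 \<in> Y \<Longrightarrow> (1, \<lambda>t\<in>{..1}. y0) \<in> based_loops Y y0"
  by (auto simp: based_loops_iff walk_def points_def)

text \<open>The union over all representatives of a class, which is how operations on classes are defined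
  here, collapses for a function that respects deformation.\<close>

lemma UN_loop_class:
  assumes "\<alpha> \<in> based_loops Y y0"
    and "\<And>\<beta>. \<beta> \<in> based_loops Y y0 \<Longrightarrow> deform Y (points \<alpha>) (points \<beta>) \<Longrightarrow> F \<beta> = F \<alpha>"
  shows "(\<Union>\<beta>\<in>loop_class Y y0 \<alpha>. F \<beta>) = F \<alpha>"
  using assms by (force simp: loop_class_eq_Collect)

lemma mult_loop_class:
  assumes "\<alpha> \<in> based_loops Y y0" "\<beta> \<in> based_loops Y y0"
  shows "loop_class Y y0 \<alpha> \<otimes>\<^bsub>fundamental_group Y y0\<^esub> loop_class Y y0 \<beta> = loop_class Y y0 (\<alpha> \<cdot> \<beta>)"
proof -
  have mem: "a \<cdot> b \<in> based_loops Y y0" if "a \<in> based_loops Y y0" "b \<in> based_loops Y y0" for a b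
    using that by (intro concat_based_loops) (auto simp: based_loops_iff)
  have "(\<Union>b\<in>loop_class Y y0 \<beta>. loop_class Y y0 (a \<cdot> b)) = loop_class Y y0 (a \<cdot> \<beta>)"
    if "a \<in> based_loops Y y0" for a
    using assms that by (intro UN_loop_class) (auto simp: loop_class_eq_iff mem intro: deform_append deform_sym)
  then have "(\<Union>a\<in>loop_class Y y0 \<alpha>. \<Union>b\<in>loop_class Y y0 \<beta>. loop_class Y y0 (a \<cdot> b))
      = (\<Union>a\<in>loop_class Y y0 \<alpha>. loop_class Y y0 (a \<cdot> \<beta>))"
    using assms by (intro SUP_cong) (auto simp: loop_class_eq_Collect)
  also have "\<dots> = loop_class Y y0 (\<alpha> \<cdot> \<beta>)"
    using assms by (intro UN_loop_class) (auto simp: loop_class_eq_iff mem intro: deform_append deform_sym)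
  finally show ?thesis by (simp add: fundamental_group_def)
qed

lemma points_constant: "points (Suc 0, \<lambda>t\<in>{..Suc 0}. y) = [y, y]"
  by (simp add: points_def)

text \<open>The unit is a loop of length 1, that is, the list \<open>[y0, y0]\<close>; multiplying by it only adds stutters.
  Inverses are reversed loops, by \<open>deform_rev_append\<close>, and associativity is that of \<open>@\<close>.\<close>

theorem group_fundamental_group:
  assumes "y0 \<in> Y"
  shows "group (fundamental_group Y y0)"
proof (rule groupI)
  let ?G = "fundamental_group Y y0" and ?L = "based_loops Y y0" and ?c = "loop_class Y y0"
  have mem: "a \<cdot> b \<in> ?L" if "a \<in> ?L" "b \<in> ?L" for a b
    using that by (intro concat_based_loops) (auto simp: based_loops_iff)
  have one: "\<one>\<^bsub>?G\<^esub> = ?c (1, \<lambda>t\<in>{..1}. y0)"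
    by (simp add: fundamental_group_def)
  note const = constant_based_loops[OF assms]
  show "\<one>\<^bsub>?G\<^esub> \<in> carrier ?G"
    using const by (simp add: one carrier_fundamental_group)
  show "x \<otimes>\<^bsub>?G\<^esub> y \<in> carrier ?G" if "x \<in> carrier ?G" "y \<in> carrier ?G" for x y
    using that by (auto simp: carrier_fundamental_group mult_loop_class mem)
  show "x \<otimes>\<^bsub>?G\<^esub> y \<otimes>\<^bsub>?G\<^esub> z = x \<otimes>\<^bsub>?G\<^esub> (y \<otimes>\<^bsub>?G\<^esub> z)"
    if xyz: "x \<in> carrier ?G" "y \<in> carrier ?G" "z \<in> carrier ?G" for x y z
  proof -
    obtain a b c where "a \<in> ?L" "x = ?c a" "b \<in> ?L" "y = ?c b" "c \<in> ?L" "z = ?c c"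
      using xyz unfolding carrier_fundamental_group by blast
    then show ?thesis
      by (simp add: mult_loop_class mem loop_class_eq_iff)
  qed
  show "\<one>\<^bsub>?G\<^esub> \<otimes>\<^bsub>?G\<^esub> x = x" if x: "x \<in> carrier ?G" for x
  proof -
    obtain a where a: "a \<in> ?L" "x = ?c a"
      using x by (auto simp: carrier_fundamental_group)
    have "deform Y ([y0] @ [y0] @ points a) ([y0] @ points a)"
      using deform_stutter[of Y "[]" y0 "points a"] by simp
    also have "deform Y ([y0] @ points a) (points a)"
      using deform_hd_append[of "points a" Y] a by (simp add: based_loops_iff)
    finally show ?thesis
      using a const by (simp add: one mult_loop_class mem loop_class_eq_iff points_constant del: restrict_apply)
  qed
  show "\<exists>y\<in>carrier ?G. y \<otimes>\<^bsub>?G\<^esub> x = \<one>\<^bsub>?G\<^esub>" if x: "x \<in> carrier ?G" for x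
  proof -
    obtain a where a: "a \<in> ?L" "x = ?c a"
      using x by (auto simp: carrier_fundamental_group)
    have "deform Y (rev (points a) @ points a) [y0]"
      using deform_rev_append[of Y "points a"] a by (simp add: based_loops_iff)
    also have "deform Y [y0] [y0, y0]"
      using deform_sym[OF deform_stutter[of Y "[]" y0 "[]"]] by simp
    finally have "?c (path_reverse a) \<otimes>\<^bsub>?G\<^esub> x = \<one>\<^bsub>?G\<^esub>"
      using a const reverse_based_loops[OF a(1)]
      by (simp add: one mult_loop_class mem loop_class_eq_iff points_constant del: restrict_apply)
    then show ?thesis
      using reverse_based_loops[OF a(1)] by (auto simp: carrier_fundamental_group)
  qed
qed

section \<open>Change of basepoint\<close>

lemma deform_cancel_left:
  assumes "walk Y xs" "zs \<noteq> []" "hd zs = hd xs"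
  shows "deform Y (xs @ rev xs @ zs) zs"
proof -
  have "deform Y ((xs @ rev xs) @ zs) ([hd zs] @ zs)"
    using deform_append[OF deform_append_rev[OF assms(1)] deform_refl, of zs] assms(3) by simp
  also have "deform Y ([hd zs] @ zs) zs"
    using assms(2) by (rule deform_hd_append)
  finally show ?thesis by simp
qed

lemma deform_cancel_right:
  assumes "walk Y xs" "zs \<noteq> []" "last zs = hd xs"
  shows "deform Y (zs @ xs @ rev xs) zs"
proof -
  have "deform Y (zs @ xs @ rev xs) (zs @ [last zs])"
    using deform_append[OF deform_refl deform_append_rev[OF assms(1)], of zs] assms(3) by simp
  also have "deform Y (zs @ [last zs]) zs"
    using assms(2) by (rule deform_append_last)
  finally show ?thesis .
qed

lemma deform_conjugate_back:
  assumes "walk Y xs" "zs \<noteq> []" "hd zs = hd xs" "last zs = hd xs"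
  shows "deform Y (xs @ (rev xs @ zs @ xs) @ rev xs) zs"
proof -
  have "deform Y ((xs @ rev xs @ zs) @ xs @ rev xs) (zs @ xs @ rev xs)"
    using assms by (intro deform_append deform_cancel_left deform_refl)
  also have "deform Y (zs @ xs @ rev xs) zs"
    using assms by (intro deform_cancel_right)
  finally show ?thesis by simp
qed

text \<open>Conjugation by the path is multiplicative since \<open>g \<cdot> path_reverse g\<close> can be inserted between two
  loops, and conjugation by the reversed path undoes it, by \<open>deform_conjugate_back\<close>.\<close>

theorem change_of_basepoint_iso:
  assumes walk: "walk Y (points g)" and ends: "hd (points g) = y0'" "last (points g) = y0"
  shows "\<exists>\<Phi> \<in> iso (fundamental_group Y y0') (fundamental_group Y y0).
       \<forall>\<alpha> \<in> based_loops Y y0'.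
         \<Phi> (loop_class Y y0' \<alpha>) = loop_class Y y0 (path_reverse g \<cdot> \<alpha> \<cdot> g)"
proof -
  let ?xs = "points g"
  define \<Phi> where "\<Phi> A = (\<Union>a\<in>A. loop_class Y y0 (path_reverse g \<cdot> a \<cdot> g))" for A
  have conj: "path_reverse g \<cdot> a \<cdot> g \<in> based_loops Y y0" if "a \<in> based_loops Y y0'" for a
    using that walk ends
    by (intro concat_based_loops) (auto simp: based_loops_iff hd_rev last_rev walk_append)
  have \<Phi>: "\<Phi> (loop_class Y y0' a) = loop_class Y y0 (path_reverse g \<cdot> a \<cdot> g)"
    if "a \<in> based_loops Y y0'" for a
    unfolding \<Phi>_def using that
    by (intro UN_loop_class) (auto simp: loop_class_eq_iff conj intro!: deform_append intro: deform_sym)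
  have mem: "a \<cdot> b \<in> based_loops Y y" if "a \<in> based_loops Y y" "b \<in> based_loops Y y" for a b y
    using that by (intro concat_based_loops) (auto simp: based_loops_iff)
  have "\<Phi> \<in> hom (fundamental_group Y y0') (fundamental_group Y y0)"
  proof (rule homI)
    fix x assume "x \<in> carrier (fundamental_group Y y0')"
    then show "\<Phi> x \<in> carrier (fundamental_group Y y0)"
      by (auto simp: carrier_fundamental_group \<Phi> conj)
  next
    fix x y assume "x \<in> carrier (fundamental_group Y y0')" "y \<in> carrier (fundamental_group Y y0')"
    then obtain a b where ab: "a \<in> based_loops Y y0'" "x = loop_class Y y0' a"
      "b \<in> based_loops Y y0'" "y = loop_class Y y0' b"
      by (auto simp: carrier_fundamental_group)
    have "deform Y (?xs @ rev ?xs @ points b) (points b)"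
      using ab walk ends by (intro deform_cancel_left) (auto simp: based_loops_iff)
    from deform_context[OF this, of "rev ?xs @ points a" ?xs]
    have "deform Y (rev ?xs @ points a @ points b @ ?xs)
        (rev ?xs @ points a @ ?xs @ rev ?xs @ points b @ ?xs)"
      by (simp add: deform_sym)
    then show "\<Phi> (x \<otimes>\<^bsub>fundamental_group Y y0'\<^esub> y) = \<Phi> x \<otimes>\<^bsub>fundamental_group Y y0\<^esub> \<Phi> y"
      using ab by (simp add: mult_loop_class mem \<Phi> conj loop_class_eq_iff)
  qed
  moreover have "inj_on \<Phi> (carrier (fundamental_group Y y0'))"
  proof (rule inj_onI)
    fix x y assume "x \<in> carrier (fundamental_group Y y0')" "y \<in> carrier (fundamental_group Y y0')"
      and eq: "\<Phi> x = \<Phi> y"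
    then obtain a b where ab: "a \<in> based_loops Y y0'" "x = loop_class Y y0' a"
      "b \<in> based_loops Y y0'" "y = loop_class Y y0' b"
      by (auto simp: carrier_fundamental_group)
    have undo: "deform Y (?xs @ (rev ?xs @ points c @ ?xs) @ rev ?xs) (points c)"
      if "c \<in> based_loops Y y0'" for c
      using that walk ends by (intro deform_conjugate_back) (auto simp: based_loops_iff)
    have "deform Y (rev ?xs @ points a @ ?xs) (rev ?xs @ points b @ ?xs)"
      using eq ab by (simp add: \<Phi> conj loop_class_eq_iff)
    then have "deform Y (?xs @ (rev ?xs @ points a @ ?xs) @ rev ?xs)
        (?xs @ (rev ?xs @ points b @ ?xs) @ rev ?xs)"
      by (rule deform_context)
    then have "deform Y (points a) (points b)"
      using undo ab by (meson deform_sym deform_trans)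
    then show "x = y"
      using ab by (simp add: loop_class_eq_iff)
  qed
  moreover have "z \<in> \<Phi> ` carrier (fundamental_group Y y0')"
    if "z \<in> carrier (fundamental_group Y y0)" for z
  proof -
    obtain b where b: "b \<in> based_loops Y y0" "z = loop_class Y y0 b"
      using \<open>z \<in> _\<close> by (auto simp: carrier_fundamental_group)
    \<comment> \<open>The preimage of a class is its conjugate by the reversed path.\<close>
    let ?a = "g \<cdot> b \<cdot> path_reverse g"
    have a: "?a \<in> based_loops Y y0'"
      using b walk ends
      by (intro concat_based_loops) (auto simp: based_loops_iff hd_rev last_rev walk_append)
    have "deform Y (rev ?xs @ (rev (rev ?xs) @ points b @ rev ?xs) @ rev (rev ?xs)) (points b)"
      using b walk ends by (intro deform_conjugate_back) (auto simp: based_loops_iff hd_rev)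
    then have "\<Phi> (loop_class Y y0' ?a) = z"
      using a b by (simp add: \<Phi> conj loop_class_eq_iff)
    then show ?thesis
      using a by (auto simp: carrier_fundamental_group)
  qed
  ultimately have "\<Phi> \<in> iso (fundamental_group Y y0') (fundamental_group Y y0)"
    unfolding iso_def bij_betw_def by (auto simp: hom_def)
  then show ?thesis using \<Phi> by blast
qed

theorem theorem3p14:
  fixes Y :: "(int ^ 'n) set" and N :: nat and \<gamma> :: "nat \<Rightarrow> int ^ 'n" and y0 y0' :: "int ^ 'n"
  assumes "digital_image Y"
    and "digital_path Y (N, \<gamma>)"
    and "\<gamma> 0 = y0'"
    and "\<gamma> N = y0"
  shows "group (fundamental_group Y y0') \<and> group (fundamental_group Y y0) \<and>
    (\<exists>\<Phi> \<in> iso (fundamental_group Y y0') (fundamental_group Y y0).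
       \<forall>\<alpha> \<in> based_loops Y y0'.
         \<Phi> (loop_class Y y0' \<alpha>) =
         loop_class Y y0 (path_reverse (N, \<gamma>) \<cdot> \<alpha> \<cdot> (N, \<gamma>)))"
proof (intro conjI)
  have walk: "walk Y (points (N, \<gamma>))"
    using assms(2) by (simp add: digital_path_iff_walk)
  have "y0' \<in> Y" "y0 \<in> Y"
    using walk hd_in_set[of "points (N, \<gamma>)"] last_in_set[of "points (N, \<gamma>)"] assms(3,4)
    by (auto simp: walk_def)
  then show "group (fundamental_group Y y0')" "group (fundamental_group Y y0)"
    by (simp_all add: group_fundamental_group)
  show "\<exists>\<Phi> \<in> iso (fundamental_group Y y0') (fundamental_group Y y0).
       \<forall>\<alpha> \<in> based_loops Y y0'.
         \<Phi> (loop_class Y y0' \<alpha>) = loop_class Y y0 (path_reverse (N, \<gamma>) \<cdot> \<alpha> \<cdot> (N, \<gamma>))"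
    using walk assms(3,4) by (intro change_of_basepoint_iso) simp_all
qed

end
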